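(* Let $\Gamma$ be a countably infinite group and let $(D_n)_{n \in \mathbb{N}}$ be a sequence of finite subsets of $\Gamma$ such that $|D_n|/\log n \to \infty$. Then, for all $f \in L^1(\Omega, \boldsymbol{\lambda})$, $$\lim_{n \to \infty} \mathbb{E}_{D_n} f = \mathbb{E}_{\boldsymbol{\lambda}} f \qquad \text{in } L^1(\Omega, \boldsymbol{\lambda}).$$
   Context: $\Omega = [0;1]^\Gamma$ and $\boldsymbol{\lambda} = \lambda^\Gamma$, where $\lambda$ is the Lebesgue probability measure on $[0;1]$. The group $\Gamma$ acts on $\Omega$ by the shift action $(\gamma \cdot x)(\delta) = x(\delta\gamma)$ for $x \in \Omega$, $\gamma,\delta \in \Gamma$; it preserves $\boldsymbol{\lambda}$. The global average is $\mathbb{E}_{\boldsymbol{\lambda}} f = \int_\Omega f \, d\boldsymbol{\lambda}$ (viewed as a constant function where appropriate). For a nonempty finite $D \subset \Gamma$, the function $\mathbb{E}_D f$ is given by $\mathbb{E}_D f(x) = \frac{1}{|D|}\sum_{\delta \in D} f(\delta \cdot x)$. (The growth assumption implies $D_n \neq \varnothing$ for all large $n$.) *)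

theory Defs
  imports "HOL-Probability.Probability" "HOL-Algebra.Group"
begin

text \<open>The probability space \<open>([0;1], \<lambda>)\<close>, with its Borel sets.\<close>

definition unit_interval_measure :: "real measure" where
  "unit_interval_measure = restrict_space lborel {0..1}"

text \<open>The points of \<open>[0;1]\<^sup>\<Gamma>\<close> are represented, as always for \<^const>\<open>PiM\<close>, by the
  functions that map \<open>carrier \<Gamma>\<close> into \<open>[0;1]\<close> and are \<^const>\<open>undefined\<close> elsewhere.\<close>

definition bernoulli_space :: "('a, 'b) monoid_scheme \<Rightarrow> ('a \<Rightarrow> real) measure" where
  "bernoulli_space \<Gamma> = PiM (carrier \<Gamma>) (\<lambda>_. unit_interval_measure)"

definition shift :: "('a, 'b) monoid_scheme \<Rightarrow> 'a \<Rightarrow> ('a \<Rightarrow> real) \<Rightarrow> ('a \<Rightarrow> real)" where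
  "shift \<Gamma> \<gamma> x = (\<lambda>\<delta>\<in>carrier \<Gamma>. x (\<delta> \<otimes>\<^bsub>\<Gamma>\<^esub> \<gamma>))"

definition local_average ::
  "('a, 'b) monoid_scheme \<Rightarrow> 'a set \<Rightarrow> (('a \<Rightarrow> real) \<Rightarrow> real) \<Rightarrow> ('a \<Rightarrow> real) \<Rightarrow> real" where
  "local_average \<Gamma> D f x = (1 / real (card D)) * (\<Sum>\<delta>\<in>D. f (shift \<Gamma> \<delta> x))"

definition global_average ::
  "('a, 'b) monoid_scheme \<Rightarrow> (('a \<Rightarrow> real) \<Rightarrow> real) \<Rightarrow> real" where
  "global_average \<Gamma> f = (LINT x|bernoulli_space \<Gamma>. f x)"

text \<open>The integrability clauses are needed because \<^const>\<open>lebesgue_integral\<close> is 0 on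
  non-integrable functions. Finitely many terms of the sequence may lie outside \<open>L\<^sup>1\<close>.\<close>

definition tendsto_L1 :: "'x measure \<Rightarrow> (nat \<Rightarrow> 'x \<Rightarrow> real) \<Rightarrow> ('x \<Rightarrow> real) \<Rightarrow> bool" where
  "tendsto_L1 M F g \<longleftrightarrow>
     (\<forall>\<^sub>F n in sequentially. integrable M (F n)) \<and> integrable M g \<and>
     (\<lambda>n. LINT x|M. \<bar>F n x - g x\<bar>) \<longlonglongrightarrow> 0"

lemma prob_space_unit_interval_measure: "prob_space unit_interval_measure"
  by (rule prob_spaceI)
    (simp add: unit_interval_measure_def emeasure_restrict_space space_restrict_space)

lemma prob_space_bernoulli_space: "prob_space (bernoulli_space \<Gamma>)"
  unfolding bernoulli_space_def
  by (rule prob_space_PiM) (rule prob_space_unit_interval_measure)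

lemma space_bernoulli_space: "space (bernoulli_space \<Gamma>) = (carrier \<Gamma> \<rightarrow>\<^sub>E {0..1})"
  by (simp add: bernoulli_space_def space_PiM unit_interval_measure_def space_restrict_space)

lemma (in group) shift_mult:
  assumes "\<gamma> \<in> carrier G" "\<delta> \<in> carrier G"
  shows "shift G \<gamma> (shift G \<delta> x) = shift G (\<gamma> \<otimes> \<delta>) x"
  using assms by (auto simp: shift_def restrict_def m_assoc)

end

theory Submission
  imports Defs
begin

text \<open>
  If \<open>A\<close> is a cylinder over the finite set \<open>J\<close> of coordinates, then the events
  \<open>shift \<delta> x \<in> A\<close> and \<open>shift \<delta>' x \<in> A\<close> are independent as soon as \<open>J\<delta>\<close> and \<open>J\<delta>'\<close> are disjoint,
  that is, unless \<open>\<delta>' \<in> J\<^sup>-\<^sup>1J\<delta>\<close>. So each summand of a local average of the indicator of \<open>A\<close> is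
  correlated with at most \<open>|J|\<^sup>2\<close> others, and the average is within \<open>|J| / \<surd>|D|\<close> of its mean
  in \<open>L\<^sup>2\<close>, hence in \<open>L\<^sup>1\<close>; the growth assumption makes \<open>|D\<^sub>n|\<close> tend to infinity. Averaging
  operators are contractions of \<open>L\<^sup>1\<close>, so the functions for which the claim holds form a closed
  subspace of \<open>L\<^sup>1\<close>, which contains all indicators by the \<open>\<pi>\<close>-\<open>\<lambda>\<close> theorem.
\<close>

section \<open>Second moment bound for sums with few correlated pairs\<close>

text \<open>The first moment is bounded through the second, whose expansion is a matrix of
  expectations \<open>Z i * Z j\<close>. Row \<open>i\<close> vanishes off \<open>N\<close>, so it
  has at most \<open>k\<close> nonzero entries, each at most 1. The set \<open>N\<close> may contain
  \<open>i\<close> itself, which accounts for the diagonal.\<close>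

lemma (in prob_space) expectation_abs_sum_le_sqrt:
  fixes Z :: "'i \<Rightarrow> 'a \<Rightarrow> real"
  assumes "finite I"
    and meas [measurable]: "\<And>i. i \<in> I \<Longrightarrow> Z i \<in> borel_measurable M"
    and bound: "\<And>i x. i \<in> I \<Longrightarrow> x \<in> space M \<Longrightarrow> \<bar>Z i x\<bar> \<le> 1"
    and uncorrelated: "\<And>i. i \<in> I \<Longrightarrow>
      \<exists>N. finite N \<and> card N \<le> k \<and> (\<forall>j\<in>I - N. expectation (\<lambda>x. Z i x * Z j x) = 0)"
  shows "expectation (\<lambda>x. \<bar>\<Sum>i\<in>I. Z i x\<bar>) \<le> sqrt (real (card I) * real k)"
proof -
  let ?S = "\<lambda>x. \<Sum>i\<in>I. Z i x"
  have prod_bound: "\<bar>Z i x * Z j x\<bar> \<le> 1" if "i \<in> I" "j \<in> I" "x \<in> space M" for i j x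
    using mult_mono[OF bound[OF that(1,3)] bound[OF that(2,3)]] by (simp add: abs_mult)
  have int: "integrable M (Z i)" if "i \<in> I" for i
    using that bound by (intro integrable_const_bound[where B = 1] AE_I2) auto
  have int2: "integrable M (\<lambda>x. Z i x * Z j x)" if "i \<in> I" "j \<in> I" for i j
    using that prod_bound by (intro integrable_const_bound[where B = 1] AE_I2) auto
  \<comment> \<open>The absolute value stays under the square to match the variance of
    \<open>\<bar>?S x\<bar>\<close>, whose nonnegativity gives the passage from the first to the
    second moment below.\<close>
  have sq: "\<bar>?S x\<bar>\<^sup>2 = (\<Sum>i\<in>I. \<Sum>j\<in>I. Z i x * Z j x)" for x
    by (simp add: power2_eq_square sum_product)
  have int_sq: "integrable M (\<lambda>x. \<bar>?S x\<bar>\<^sup>2)"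
    unfolding sq by (intro Bochner_Integration.integrable_sum int2)
  have "(expectation (\<lambda>x. \<bar>?S x\<bar>))\<^sup>2 \<le> expectation (\<lambda>x. \<bar>?S x\<bar>\<^sup>2)"
  proof -
    have "integrable M (\<lambda>x. \<bar>?S x\<bar>)" using int by simp
    from variance_eq[OF this int_sq] variance_positive[of "\<lambda>x. \<bar>?S x\<bar>"]
    show ?thesis by linarith
  qed
  also have "\<dots> = (\<Sum>i\<in>I. \<Sum>j\<in>I. expectation (\<lambda>x. Z i x * Z j x))"
    unfolding sq by (simp add: Bochner_Integration.integral_sum int2)
  also have "\<dots> \<le> (\<Sum>i\<in>I. real k)"
  proof (rule sum_mono)
    fix i assume i: "i \<in> I"
    obtain N where N: "finite N" "card N \<le> k"
      and zero: "\<And>j. j \<in> I - N \<Longrightarrow> expectation (\<lambda>x. Z i x * Z j x) = 0"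
      using uncorrelated[OF i] by blast
    have "(\<Sum>j\<in>I. expectation (\<lambda>x. Z i x * Z j x)) = (\<Sum>j\<in>I \<inter> N. expectation (\<lambda>x. Z i x * Z j x))"
      using \<open>finite I\<close> zero by (intro sum.mono_neutral_right) auto
    also have "\<dots> \<le> (\<Sum>j\<in>I \<inter> N. 1)"
    proof (rule sum_mono)
      fix j assume "j \<in> I \<inter> N"
      then have "expectation (\<lambda>x. Z i x * Z j x) \<le> expectation (\<lambda>x. 1)"
        using i prod_bound int2 by (intro integral_mono) (auto simp: abs_le_iff)
      then show "expectation (\<lambda>x. Z i x * Z j x) \<le> 1"
        by (simp add: prob_space)
    qed
    also have "\<dots> \<le> real k"
      using card_mono[OF N(1), of "I \<inter> N"] N(2) by simp
    finally show "(\<Sum>j\<in>I. expectation (\<lambda>x. Z i x * Z j x)) \<le> real k" .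
  qed
  finally show ?thesis
    by (intro real_le_rsqrt) simp
qed

section \<open>Shift invariance and averaging operators on L^1\<close>

context group
begin

lemma measurable_shift [measurable]:
  assumes "\<delta> \<in> carrier G"
  shows "shift G \<delta> \<in> measurable (bernoulli_space G) (bernoulli_space G)"
  unfolding bernoulli_space_def shift_def
  using assms by (intro measurable_restrict measurable_component_singleton) auto

text \<open>Right translation is an injective map of the coordinates, and injective reindexing
  preserves a product of identical probability measures.\<close>

lemma distr_shift:
  assumes "\<delta> \<in> carrier G"
  shows "distr (bernoulli_space G) (bernoulli_space G) (shift G \<delta>) = bernoulli_space G"
proof -
  have "inj_on (\<lambda>\<gamma>. \<gamma> \<otimes> \<delta>) (carrier G)"
    using assms by (auto intro!: inj_onI)
  then show ?thesis
    unfolding bernoulli_space_def shift_def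
    using assms prob_space_unit_interval_measure
    by (intro distr_PiM_reindex) auto
qed

lemma
  fixes f :: "('a \<Rightarrow> real) \<Rightarrow> real"
  assumes "\<delta> \<in> carrier G" and "integrable (bernoulli_space G) f"
  shows integrable_shift: "integrable (bernoulli_space G) (\<lambda>x. f (shift G \<delta> x))"
    and integral_shift: "(LINT x|bernoulli_space G. f (shift G \<delta> x)) = (LINT x|bernoulli_space G. f x)"
proof -
  have f: "integrable (distr (bernoulli_space G) (bernoulli_space G) (shift G \<delta>)) f"
    using assms by (simp add: distr_shift)
  then show "integrable (bernoulli_space G) (\<lambda>x. f (shift G \<delta> x))"
    using assms by (intro integrable_distr[OF measurable_shift])
  show "(LINT x|bernoulli_space G. f (shift G \<delta> x)) = (LINT x|bernoulli_space G. f x)"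
    \<comment> \<open>Only the measure on the right is written as an image measure; changing
      variables there produces the left side.\<close>
    using assms by (subst (2) distr_shift[OF assms(1), symmetric], subst integral_distr) auto
qed

lemma integrable_local_average:
  assumes "D \<subseteq> carrier G" and "integrable (bernoulli_space G) f"
  shows "integrable (bernoulli_space G) (local_average G D f)"
  unfolding local_average_def
  using assms by (intro integrable_mult_right Bochner_Integration.integrable_sum integrable_shift) auto

text \<open>The triangle inequality moves the absolute value inside the sum, and by invariance every
  summand then has the same integral. This contraction property makes the approximation argument
  uniform in the averaging set.\<close>

lemma integral_abs_local_average_le:
  assumes "D \<subseteq> carrier G" and f: "integrable (bernoulli_space G) f"
  shows "(LINT x|bernoulli_space G. \<bar>local_average G D f x\<bar>) \<le> (LINT x|bernoulli_space G. \<bar>f x\<bar>)"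
proof -
  let ?M = "bernoulli_space G"
  have int: "integrable ?M (\<lambda>x. \<bar>f (shift G \<delta> x)\<bar>)" if "\<delta> \<in> D" for \<delta>
    using that assms by (intro integrable_abs integrable_shift) auto
  have "(LINT x|?M. \<bar>local_average G D f x\<bar>)
      \<le> (LINT x|?M. (1 / real (card D)) * (\<Sum>\<delta>\<in>D. \<bar>f (shift G \<delta> x)\<bar>))"
  proof (rule integral_mono)
    show "integrable ?M (\<lambda>x. \<bar>local_average G D f x\<bar>)"
      using integrable_local_average[OF assms] by simp
    show "integrable ?M (\<lambda>x. (1 / real (card D)) * (\<Sum>\<delta>\<in>D. \<bar>f (shift G \<delta> x)\<bar>))"
      by (intro integrable_mult_right Bochner_Integration.integrable_sum int)
    show "\<bar>local_average G D f x\<bar> \<le> (1 / real (card D)) * (\<Sum>\<delta>\<in>D. \<bar>f (shift G \<delta> x)\<bar>)" for x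
      unfolding local_average_def abs_mult
      by (intro mult_mono sum_abs) auto
  qed
  also have "\<dots> = (1 / real (card D)) * (\<Sum>\<delta>\<in>D. LINT x|?M. \<bar>f (shift G \<delta> x)\<bar>)"
    by (simp add: Bochner_Integration.integral_sum int)
  also have "(\<Sum>\<delta>\<in>D. LINT x|?M. \<bar>f (shift G \<delta> x)\<bar>) = (\<Sum>\<delta>\<in>D. LINT x|?M. \<bar>f x\<bar>)"
    using assms by (intro sum.cong refl integral_shift[where f = "\<lambda>x. \<bar>f x\<bar>"]) auto
  \<comment> \<open>If \<open>D\<close> is empty or infinite, its \<open>card\<close> is 0 and the
    left side is 0; otherwise equality holds.\<close>
  also have "(1 / real (card D)) * \<dots> \<le> (LINT x|?M. \<bar>f x\<bar>)"
    by (cases "card D = 0") auto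
  finally show ?thesis .
qed

lemma local_average_add:
  "local_average G D (\<lambda>x. f x + g x) x = local_average G D f x + local_average G D g x"
  by (simp add: local_average_def sum.distrib distrib_left)

lemma local_average_mult:
  "local_average G D (\<lambda>x. c * f x) x = c * local_average G D f x"
  by (simp add: local_average_def sum_distrib_left mult_ac)

section \<open>Independence of shifted cylinders\<close>

lemma prod_emb_PiE_eq_Collect:
  "prod_emb (carrier G) (\<lambda>_. unit_interval_measure) K (Pi\<^sub>E K E)
    = {x \<in> space (bernoulli_space G). \<forall>i\<in>K. x i \<in> E i}"
  unfolding prod_emb_def bernoulli_space_def space_PiM
  by (auto simp: restrict_PiE_iff)

text \<open>Coordinate \<open>j\<close> of the shifted point is coordinate
  \<open>j \<otimes> \<delta>\<close> of \<open>x\<close>, so the preimage of a cylinder is again a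
  cylinder, with every constraint moved from \<open>j\<close> to
  \<open>j \<otimes> \<delta>\<close>.\<close>

lemma shift_cylinder_iff:
  assumes "J \<subseteq> carrier G" "\<delta> \<in> carrier G" "x \<in> space (bernoulli_space G)"
  shows "shift G \<delta> x \<in> prod_emb (carrier G) (\<lambda>_. unit_interval_measure) J (Pi\<^sub>E J E)
    \<longleftrightarrow> (\<forall>i\<in>(\<lambda>j. j \<otimes> \<delta>) ` J. x i \<in> E (i \<otimes> inv \<delta>))"
proof -
  have "shift G \<delta> x \<in> space (bernoulli_space G)"
    using assms by (intro measurable_space[OF measurable_shift])
  then have "shift G \<delta> x \<in> prod_emb (carrier G) (\<lambda>_. unit_interval_measure) J (Pi\<^sub>E J E)
      \<longleftrightarrow> (\<forall>j\<in>J. shift G \<delta> x j \<in> E j)"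
    by (simp add: prod_emb_PiE_eq_Collect)
  \<comment> \<open>Writing \<open>j\<close> as
    \<open>j \<otimes> \<delta> \<otimes> inv \<delta>\<close> makes the condition depend on
    \<open>j \<otimes> \<delta>\<close> alone, so that the quantifier can range over the translate
    of \<open>J\<close>.\<close>
  also have "\<dots> \<longleftrightarrow> (\<forall>j\<in>J. x (j \<otimes> \<delta>) \<in> E (j \<otimes> \<delta> \<otimes> inv \<delta>))"
    using assms by (intro ball_cong refl) (auto simp: shift_def m_assoc subset_iff)
  finally show ?thesis by simp
qed

text \<open>Both conditions together define one cylinder over the union of the two translates of
  \<open>J\<close>. Its measure is a product over a disjoint union, and since right translations are
  injective, each translate contributes the full product for \<open>A\<close>.\<close>

lemma measure_shift_cylinder_Int:
  fixes E :: "'a \<Rightarrow> real set"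
  assumes J: "finite J" "J \<subseteq> carrier G" "\<And>j. j \<in> J \<Longrightarrow> E j \<in> sets unit_interval_measure"
    and \<delta>: "\<delta> \<in> carrier G" "\<delta>' \<in> carrier G"
    and disjoint: "(\<lambda>j. j \<otimes> \<delta>) ` J \<inter> (\<lambda>j. j \<otimes> \<delta>') ` J = {}"
  defines "A \<equiv> prod_emb (carrier G) (\<lambda>_. unit_interval_measure) J (Pi\<^sub>E J E)"
  shows "measure (bernoulli_space G)
      {x \<in> space (bernoulli_space G). shift G \<delta> x \<in> A \<and> shift G \<delta>' x \<in> A}
    = (measure (bernoulli_space G) A)\<^sup>2"
proof -
  let ?U = unit_interval_measure
  let ?K = "(\<lambda>j. j \<otimes> \<delta>) ` J" and ?K' = "(\<lambda>j. j \<otimes> \<delta>') ` J"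
  \<comment> \<open>\<open>F\<close> glues the two families of constraints. Disjointness ensures
    that the points of \<open>?K'\<close> fall into the second branch.\<close>
  define F where "F i = (if i \<in> ?K then E (i \<otimes> inv \<delta>) else E (i \<otimes> inv \<delta>'))" for i
  interpret U: prob_space ?U by (rule prob_space_unit_interval_measure)
  interpret P: product_prob_space "\<lambda>_. ?U" "carrier G" by unfold_locales
  have cancel: "j \<otimes> \<gamma> \<otimes> inv \<gamma> = j" if "j \<in> J" "\<gamma> \<in> carrier G" for j \<gamma>
    using that J by (auto simp: m_assoc subset_iff)
  have inj: "inj_on (\<lambda>j. j \<otimes> \<gamma>) J" if "\<gamma> \<in> carrier G" for \<gamma>
    by (rule inj_on_inverseI[where g = "\<lambda>i. i \<otimes> inv \<gamma>"]) (rule cancel[OF _ that])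
  have F: "F (j \<otimes> \<delta>) = E j" "F (j \<otimes> \<delta>') = E j" if "j \<in> J" for j
    using that disjoint cancel \<delta> by (auto simp: F_def)
  have "{x \<in> space (bernoulli_space G). shift G \<delta> x \<in> A \<and> shift G \<delta>' x \<in> A}
      = prod_emb (carrier G) (\<lambda>_. ?U) (?K \<union> ?K') (Pi\<^sub>E (?K \<union> ?K') F)"
  proof -
    have "shift G \<delta> x \<in> A \<and> shift G \<delta>' x \<in> A \<longleftrightarrow> (\<forall>i\<in>?K \<union> ?K'. x i \<in> F i)"
      if "x \<in> space (bernoulli_space G)" for x
      unfolding A_def shift_cylinder_iff[OF J(2) \<delta>(1) that] shift_cylinder_iff[OF J(2) \<delta>(2) that]
      by (simp add: ball_Un F cancel \<delta>)
    moreover have "prod_emb (carrier G) (\<lambda>_. ?U) (?K \<union> ?K') (Pi\<^sub>E (?K \<union> ?K') F)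
        = {x \<in> space (bernoulli_space G). \<forall>i\<in>?K \<union> ?K'. x i \<in> F i}"
      by (rule prod_emb_PiE_eq_Collect)
    ultimately show ?thesis by auto
  qed
  then have "measure (bernoulli_space G)
      {x \<in> space (bernoulli_space G). shift G \<delta> x \<in> A \<and> shift G \<delta>' x \<in> A}
      = (\<Prod>i\<in>?K \<union> ?K'. measure ?U (F i))"
    unfolding bernoulli_space_def
    using J \<delta> by (simp, intro P.measure_PiM_emb) (auto simp: F)
  also have "\<dots> = (\<Prod>j\<in>J. measure ?U (E j)) * (\<Prod>j\<in>J. measure ?U (E j))"
    using J disjoint by (simp add: prod.union_disjoint prod.reindex inj \<delta> F)
  also have "(\<Prod>j\<in>J. measure ?U (E j)) = measure (bernoulli_space G) A"
    unfolding bernoulli_space_def A_def using J by (intro P.measure_PiM_emb[symmetric]) auto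
  finally show ?thesis by (simp add: power2_eq_square)
qed

text \<open>Two translates of \<open>J\<close> meet only if
  \<open>j \<otimes> \<delta> = i \<otimes> \<delta>'\<close> for some \<open>i\<close>,
  \<open>j\<close> in \<open>J\<close>, which determines \<open>\<delta>'\<close> from the pair.
  Hence \<open>k\<close> can be |J|^2, a bound independent of \<open>\<delta>\<close>.\<close>

lemma shifts_of_cylinder_uncorrelated:
  assumes "A \<in> prod_algebra (carrier G) (\<lambda>_. unit_interval_measure)"
  defines "Z \<equiv> \<lambda>\<delta> x. indicator A (shift G \<delta> x) - measure (bernoulli_space G) A"
  obtains k where "\<And>\<delta>. \<delta> \<in> carrier G \<Longrightarrow> \<exists>N. finite N \<and> card N \<le> k \<and>
    (\<forall>\<delta>'\<in>carrier G - N. (LINT x|bernoulli_space G. Z \<delta> x * Z \<delta>' x) = 0)"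
proof -
  let ?M = "bernoulli_space G"
  interpret M: prob_space ?M by (rule prob_space_bernoulli_space)
  obtain J E where A: "A = prod_emb (carrier G) (\<lambda>_. unit_interval_measure) J (Pi\<^sub>E J E)"
    and J: "finite J" "J \<subseteq> carrier G" "\<And>j. j \<in> J \<Longrightarrow> E j \<in> sets unit_interval_measure"
    using prod_algebraE[OF assms(1)] by metis
  have [measurable]: "A \<in> sets ?M"
    unfolding bernoulli_space_def sets_PiM using assms(1) by auto
  let ?p = "measure ?M A"
  have A_int: "integrable ?M (indicator A :: _ \<Rightarrow> real)"
    by (intro integrable_real_indicator) (auto simp: M.emeasure_eq_measure)
  have zero: "(LINT x|?M. Z \<delta> x * Z \<delta>' x) = 0"
    if \<delta>: "\<delta> \<in> carrier G" "\<delta>' \<in> carrier G"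
      and disjoint: "(\<lambda>j. j \<otimes> \<delta>) ` J \<inter> (\<lambda>j. j \<otimes> \<delta>') ` J = {}" for \<delta> \<delta>'
  proof -
    note [measurable] = measurable_shift[OF \<delta>(1)] measurable_shift[OF \<delta>(2)]
    let ?B = "{x \<in> space ?M. shift G \<delta> x \<in> A \<and> shift G \<delta>' x \<in> A}"
    have int: "integrable ?M (\<lambda>x. indicator A (shift G \<gamma> x) :: real)"
      and eq: "(LINT x|?M. indicator A (shift G \<gamma> x)) = ?p" if "\<gamma> \<in> carrier G" for \<gamma>
      using integrable_shift[OF that A_int] integral_shift[OF that A_int] by simp_all
    have B_int: "integrable ?M (indicator ?B :: _ \<Rightarrow> real)"
      by (intro integrable_real_indicator) (auto simp: M.emeasure_eq_measure)
    \<comment> \<open>The product of the two indicators is the indicator of \<open>?B\<close>. By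
      invariance each mixed term integrates to \<open>?p * ?p\<close>, so the covariance is the
      measure of \<open>?B\<close> minus \<open>?p\<^sup>2\<close>.\<close>
    have "(LINT x|?M. Z \<delta> x * Z \<delta>' x)
        = (LINT x|?M. indicator ?B x - ?p * indicator A (shift G \<delta> x)
            - ?p * indicator A (shift G \<delta>' x) + ?p\<^sup>2)"
      by (intro Bochner_Integration.integral_cong refl)
        (auto simp: Z_def power2_eq_square algebra_simps split: split_indicator)
    also have "\<dots> = measure ?M ?B - ?p * ?p - ?p * ?p + ?p\<^sup>2"
      using int[OF \<delta>(1)] int[OF \<delta>(2)] B_int
      by (simp add: eq \<delta> M.prob_space)
    also have "measure ?M ?B = ?p\<^sup>2"
      unfolding A by (rule measure_shift_cylinder_Int[OF J \<delta> disjoint])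
    finally show ?thesis by (simp add: power2_eq_square)
  qed
  show thesis
  proof (rule that)
    fix \<delta> assume \<delta>: "\<delta> \<in> carrier G"
    \<comment> \<open>These are the solutions \<open>\<delta>'\<close> of
      \<open>j \<otimes> \<delta> = i \<otimes> \<delta>'\<close>; pairs with \<open>i = j\<close>
      yield \<open>\<delta>\<close> itself, the variance term.\<close>
    let ?N = "(\<lambda>(i, j). inv i \<otimes> (j \<otimes> \<delta>)) ` (J \<times> J)"
    have "card ?N \<le> card (J \<times> J)"
      using J(1) by (intro card_image_le) auto
    moreover have "(\<lambda>j. j \<otimes> \<delta>) ` J \<inter> (\<lambda>j. j \<otimes> \<delta>') ` J = {}" if "\<delta>' \<in> carrier G - ?N" for \<delta>'
    proof (rule ccontr)
      assume "\<not> ?thesis"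
      then obtain i j where ij: "i \<in> J" "j \<in> J" "j \<otimes> \<delta> = i \<otimes> \<delta>'" by auto
      moreover have "inv i \<otimes> (i \<otimes> \<delta>') = \<delta>'"
        using that ij(1) J(2) by (auto simp: subset_iff m_assoc[symmetric])
      ultimately have "\<delta>' = (\<lambda>(i, j). inv i \<otimes> (j \<otimes> \<delta>)) (i, j)" by simp
      then have "\<delta>' \<in> ?N" using ij(1,2) by blast
      then show False using that by blast
    qed
    ultimately show "\<exists>N. finite N \<and> card N \<le> card (J \<times> J) \<and>
        (\<forall>\<delta>'\<in>carrier G - N. (LINT x|?M. Z \<delta> x * Z \<delta>' x) = 0)"
      using J(1) zero \<delta> by (intro exI[of _ ?N]) auto
  qed
qed

section \<open>Closure properties of the class of functions with convergent averages\<close>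

text \<open>Averages of an integrable function are integrable, as are constants on a probability
  space. This settles the integrability clauses once and leaves only the error integral.\<close>

lemma tendsto_L1_local_average_iff:
  assumes "\<And>n. D n \<subseteq> carrier G" and "integrable (bernoulli_space G) f"
  shows "tendsto_L1 (bernoulli_space G) (\<lambda>n. local_average G (D n) f) (\<lambda>_. global_average G f)
    \<longleftrightarrow> (\<lambda>n. LINT x|bernoulli_space G. \<bar>local_average G (D n) f x - global_average G f\<bar>)
        \<longlonglongrightarrow> 0"
proof -
  interpret prob_space "bernoulli_space G" by (rule prob_space_bernoulli_space)
  show ?thesis
    using assms by (auto simp: tendsto_L1_def integrable_local_average)
qed

lemma tendsto_L1_local_average_add:
  assumes D: "\<And>n. D n \<subseteq> carrier G"
    and f: "integrable (bernoulli_space G) f"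
      "tendsto_L1 (bernoulli_space G) (\<lambda>n. local_average G (D n) f) (\<lambda>_. global_average G f)"
    and g: "integrable (bernoulli_space G) g"
      "tendsto_L1 (bernoulli_space G) (\<lambda>n. local_average G (D n) g) (\<lambda>_. global_average G g)"
  shows "tendsto_L1 (bernoulli_space G) (\<lambda>n. local_average G (D n) (\<lambda>x. f x + g x))
    (\<lambda>_. global_average G (\<lambda>x. f x + g x))"
proof -
  let ?M = "bernoulli_space G"
  interpret prob_space ?M by (rule prob_space_bernoulli_space)
  have fg: "integrable ?M (\<lambda>x. f x + g x)" using f g by simp
  let ?e = "\<lambda>h n x. \<bar>local_average G (D n) h x - global_average G h\<bar>"
  have int: "integrable ?M (?e h n)" if "integrable ?M h" for h n
    using integrable_local_average[OF D that] by auto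
  have "(\<lambda>n. (LINT x|?M. ?e f n x) + (LINT x|?M. ?e g n x)) \<longlonglongrightarrow> 0 + 0"
    using f g D by (intro tendsto_add) (auto simp: tendsto_L1_local_average_iff)
  moreover have "(LINT x|?M. ?e (\<lambda>x. f x + g x) n x) \<le> (LINT x|?M. ?e f n x) + (LINT x|?M. ?e g n x)"
    for n
  proof -
    have "(LINT x|?M. ?e (\<lambda>x. f x + g x) n x) \<le> (LINT x|?M. ?e f n x + ?e g n x)"
    proof (rule integral_mono)
      show "integrable ?M (\<lambda>x. ?e f n x + ?e g n x)"
        using f(1) g(1) by (intro Bochner_Integration.integrable_add int)
      show "?e (\<lambda>x. f x + g x) n x \<le> ?e f n x + ?e g n x" for x
        using f(1) g(1) by (simp add: local_average_add global_average_def)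
    qed (rule int[OF fg])
    then show ?thesis using int f(1) g(1) by simp
  qed
  ultimately have "(\<lambda>n. LINT x|?M. ?e (\<lambda>x. f x + g x) n x) \<longlonglongrightarrow> 0"
    by (elim Lim_null_comparison[rotated, OF tendsto_eq_rhs]) (simp_all add: always_eventually)
  then show ?thesis
    unfolding tendsto_L1_local_average_iff[OF D fg] .
qed

lemma tendsto_L1_local_average_mult:
  assumes D: "\<And>n. D n \<subseteq> carrier G"
    and f: "integrable (bernoulli_space G) f"
      "tendsto_L1 (bernoulli_space G) (\<lambda>n. local_average G (D n) f) (\<lambda>_. global_average G f)"
  shows "tendsto_L1 (bernoulli_space G) (\<lambda>n. local_average G (D n) (\<lambda>x. c * f x))
    (\<lambda>_. global_average G (\<lambda>x. c * f x))"
proof -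
  let ?M = "bernoulli_space G"
  have cf: "integrable ?M (\<lambda>x. c * f x)" using f by simp
  have "\<bar>local_average G (D n) (\<lambda>x. c * f x) x - global_average G (\<lambda>x. c * f x)\<bar>
      = \<bar>c\<bar> * \<bar>local_average G (D n) f x - global_average G f\<bar>" for n x
    using f by (simp add: local_average_mult global_average_def abs_mult[symmetric] right_diff_distrib)
  then show ?thesis
    using f(2) unfolding tendsto_L1_local_average_iff[OF D cf] tendsto_L1_local_average_iff[OF D f(1)]
    by (simp add: tendsto_mult_right_zero)
qed

text \<open>Replacing \<open>f\<close> by \<open>s i\<close> changes the error by an amount that is
  small uniformly in \<open>n\<close>, because averaging contracts L^1. So \<open>i\<close> can be
  chosen first and \<open>n\<close> afterwards.\<close>

lemma tendsto_L1_local_average_closed: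
  assumes D: "\<And>n. D n \<subseteq> carrier G"
    and f: "integrable (bernoulli_space G) f"
    and s: "\<And>i. integrable (bernoulli_space G) (s i)"
      "\<And>i. tendsto_L1 (bernoulli_space G) (\<lambda>n. local_average G (D n) (s i)) (\<lambda>_. global_average G (s i))"
    and lim: "(\<lambda>i::nat. LINT x|bernoulli_space G. \<bar>f x - s i x\<bar>) \<longlonglongrightarrow> 0"
  shows "tendsto_L1 (bernoulli_space G) (\<lambda>n. local_average G (D n) f) (\<lambda>_. global_average G f)"
proof -
  let ?M = "bernoulli_space G"
  interpret prob_space ?M by (rule prob_space_bernoulli_space)
  let ?e = "\<lambda>h n. LINT x|?M. \<bar>local_average G (D n) h x - global_average G h\<bar>"
  \<comment> \<open>The factor 2 arises because the difference \<open>f - s i\<close> enters through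
    both its local and its global average, each bounded by its L^1 norm.\<close>
  have bound: "?e f n \<le> 2 * (LINT x|?M. \<bar>f x - s i x\<bar>) + ?e (s i) n" for i n
  proof -
    define d where "d = (\<lambda>x. f x - s i x)"
    have d: "integrable ?M d" using f s by (simp add: d_def)
    have avg: "local_average G (D n) f x = local_average G (D n) d x + local_average G (D n) (s i) x" for x
      using local_average_add[of "D n" d "s i" x] by (simp add: d_def)
    have glob: "global_average G f = global_average G d + global_average G (s i)"
      using f s by (simp add: global_average_def d_def)
    note int = integrable_local_average[OF D f, of n] integrable_local_average[OF D d, of n]
      integrable_local_average[OF D s(1)[of i], of n]
    have "?e f n \<le> (LINT x|?M. \<bar>local_average G (D n) d x\<bar> + \<bar>global_average G d\<bar>
        + \<bar>local_average G (D n) (s i) x - global_average G (s i)\<bar>)"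
      using int unfolding glob by (intro integral_mono) (auto simp: avg)
    also have "\<dots> = (LINT x|?M. \<bar>local_average G (D n) d x\<bar>) + \<bar>global_average G d\<bar> + ?e (s i) n"
      using int by (simp add: prob_space)
    also have "\<bar>global_average G d\<bar> \<le> (LINT x|?M. \<bar>d x\<bar>)"
      unfolding global_average_def using integral_norm_bound[of ?M d] by simp
    finally show ?thesis
      using integral_abs_local_average_le[OF D d, of n] by (simp add: d_def)
  qed
  have "?e f \<longlonglongrightarrow> 0"
  proof (rule LIMSEQ_I)
    fix r :: real assume r: "r > 0"
    \<comment> \<open>Twice this distance stays below \<open>r / 2\<close>, leaving
      \<open>r / 2\<close> for the error of \<open>s i\<close>.\<close>
    have "\<forall>\<^sub>F i in sequentially. (LINT x|?M. \<bar>f x - s i x\<bar>) < r / 4"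
      using lim r by (intro order_tendstoD(2)) auto
    then obtain i where i: "(LINT x|?M. \<bar>f x - s i x\<bar>) < r / 4"
      by (auto simp: eventually_sequentially)
    have "?e (s i) \<longlonglongrightarrow> 0"
      using s(2)[of i] unfolding tendsto_L1_local_average_iff[OF D s(1)] .
    then have "\<forall>\<^sub>F n in sequentially. ?e (s i) n < r / 2"
      using r by (intro order_tendstoD(2)) auto
    then obtain n0 where "\<And>n. n \<ge> n0 \<Longrightarrow> ?e (s i) n < r / 2"
      by (auto simp: eventually_sequentially)
    then have "?e f n < r" if "n \<ge> n0" for n
      using bound[of n i] i that by fastforce
    then show "\<exists>n0. \<forall>n\<ge>n0. norm (?e f n - 0) < r"
      by (auto simp: abs_of_nonneg integral_nonneg_AE)
  qed
  then show ?thesis unfolding tendsto_L1_local_average_iff[OF D f] .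
qed

text \<open>Dominated convergence, with majorant \<open>\<bar>f x\<bar> + w x\<close> for the
  differences, turns pointwise limits into L^1 limits. The inductions over sets and over functions
  supply limits in this pointwise form.\<close>

lemma tendsto_L1_local_average_dominated:
  assumes D: "\<And>n. D n \<subseteq> carrier G"
    and s: "\<And>i. integrable (bernoulli_space G) (s i)"
      "\<And>i. tendsto_L1 (bernoulli_space G) (\<lambda>n. local_average G (D n) (s i)) (\<lambda>_. global_average G (s i))"
    and lim: "\<And>x. x \<in> space (bernoulli_space G) \<Longrightarrow> (\<lambda>i::nat. s i x) \<longlonglongrightarrow> f x"
    and bound: "\<And>i x. x \<in> space (bernoulli_space G) \<Longrightarrow> \<bar>s i x\<bar> \<le> w x"
    and f: "integrable (bernoulli_space G) f" and w: "integrable (bernoulli_space G) w"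
  shows "tendsto_L1 (bernoulli_space G) (\<lambda>n. local_average G (D n) f) (\<lambda>_. global_average G f)"
proof (rule tendsto_L1_local_average_closed[OF D f s])
  have "(\<lambda>i. LINT x|bernoulli_space G. \<bar>f x - s i x\<bar>) \<longlonglongrightarrow> (LINT x|bernoulli_space G. 0)"
  proof (rule integral_dominated_convergence)
    show "integrable (bernoulli_space G) (\<lambda>x. \<bar>f x\<bar> + w x)" using f w by simp
    show "AE x in bernoulli_space G. (\<lambda>i. \<bar>f x - s i x\<bar>) \<longlonglongrightarrow> 0"
    proof (rule AE_I2)
      fix x assume "x \<in> space (bernoulli_space G)"
      from tendsto_diff[OF tendsto_const[of "f x"] lim[OF this]]
      show "(\<lambda>i. \<bar>f x - s i x\<bar>) \<longlonglongrightarrow> 0" by (intro tendsto_rabs_zero) simp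
    qed
    show "AE x in bernoulli_space G. norm \<bar>f x - s i x\<bar> \<le> \<bar>f x\<bar> + w x" for i
    proof (rule AE_I2)
      fix x assume "x \<in> space (bernoulli_space G)"
      from bound[OF this, of i] show "norm \<bar>f x - s i x\<bar> \<le> \<bar>f x\<bar> + w x" by simp
    qed
  qed (use f s in auto)
  then show "(\<lambda>i. LINT x|bernoulli_space G. \<bar>f x - s i x\<bar>) \<longlonglongrightarrow> 0" by simp
qed

section \<open>Convergence for indicators\<close>

text \<open>The second moment bound applies to the centered shifted indicators over
  \<open>D n\<close>. Dividing it by |D_n| leaves an error of at most sqrt(k / |D_n|), with
  \<open>k\<close> depending only on \<open>A\<close>.\<close>

lemma tendsto_L1_local_average_cylinder:
  assumes D: "\<And>n. D n \<subseteq> carrier G" "\<And>n. finite (D n)"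
    and card: "filterlim (\<lambda>n. real (card (D n))) at_top sequentially"
    and A: "A \<in> prod_algebra (carrier G) (\<lambda>_. unit_interval_measure)"
  shows "tendsto_L1 (bernoulli_space G) (\<lambda>n. local_average G (D n) (indicator A))
    (\<lambda>_. global_average G (indicator A))"
proof -
  let ?M = "bernoulli_space G"
  interpret prob_space ?M by (rule prob_space_bernoulli_space)
  have A_sets [measurable]: "A \<in> sets ?M"
    unfolding bernoulli_space_def sets_PiM using A by auto
  have glob: "global_average G (indicator A) = prob A"
    by (simp add: global_average_def)
  let ?Z = "\<lambda>\<delta> x. indicator A (shift G \<delta> x) - prob A :: real"
  obtain k where k: "\<And>\<delta>. \<delta> \<in> carrier G \<Longrightarrow> \<exists>N. finite N \<and> card N \<le> k \<and>
      (\<forall>\<delta>'\<in>carrier G - N. expectation (\<lambda>x. ?Z \<delta> x * ?Z \<delta>' x) = 0)"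
    using shifts_of_cylinder_uncorrelated[OF A] by blast
  let ?e = "\<lambda>n. expectation (\<lambda>x. \<bar>local_average G (D n) (indicator A) x - global_average G (indicator A)\<bar>)"
  \<comment> \<open>For empty \<open>D n\<close> the local average is 0, so subtracting
    \<open>prob A\<close> would not amount to centering each summand.\<close>
  have bound: "?e n \<le> sqrt (real k) * inverse (sqrt (real (card (D n))))" if pos: "real (card (D n)) > 0" for n
  proof -
    have "local_average G (D n) (indicator A) x - prob A = (\<Sum>\<delta>\<in>D n. ?Z \<delta> x) / real (card (D n))" for x
      using pos by (simp add: local_average_def sum_subtractf diff_divide_distrib)
    then have "?e n = expectation (\<lambda>x. \<bar>\<Sum>\<delta>\<in>D n. ?Z \<delta> x\<bar>) / real (card (D n))"
      by (simp add: glob)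
    also have "expectation (\<lambda>x. \<bar>\<Sum>\<delta>\<in>D n. ?Z \<delta> x\<bar>) \<le> sqrt (real (card (D n)) * real k)"
    proof (rule expectation_abs_sum_le_sqrt[OF D(2)])
      fix \<delta> assume "\<delta> \<in> D n"
      then have \<delta>: "\<delta> \<in> carrier G" using D(1) by blast
      note [measurable] = measurable_shift[OF \<delta>]
      show "?Z \<delta> \<in> borel_measurable ?M" by measurable
      show "\<bar>?Z \<delta> x\<bar> \<le> 1" for x
        using prob_le_1[of A] by (auto split: split_indicator)
      show "\<exists>N. finite N \<and> card N \<le> k \<and> (\<forall>\<delta>'\<in>D n - N. expectation (\<lambda>x. ?Z \<delta> x * ?Z \<delta>' x) = 0)"
        using k[OF \<delta>] D(1) by (meson Diff_iff subset_iff)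
    qed
    also have "sqrt (real (card (D n)) * real k) / real (card (D n))
        = sqrt (real k) * inverse (sqrt (real (card (D n))))"
      using pos by (simp add: real_sqrt_mult field_simps)
    finally show ?thesis using pos by (simp add: divide_right_mono)
  qed
  have "filterlim (\<lambda>n. sqrt (real (card (D n)))) at_top sequentially"
    by (rule filterlim_compose[OF sqrt_at_top card])
  then have "(\<lambda>n. sqrt (real k) * inverse (sqrt (real (card (D n))))) \<longlonglongrightarrow> 0"
    by (intro tendsto_mult_right_zero tendsto_inverse_0_at_top)
  moreover have "\<forall>\<^sub>F n in sequentially. ?e n \<le> sqrt (real k) * inverse (sqrt (real (card (D n))))"
    using card[THEN filterlim_at_top_dense[THEN iffD1], rule_format, of 0]
    by eventually_elim (rule bound)
  ultimately have "?e \<longlonglongrightarrow> 0"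
    by (elim Lim_null_comparison[rotated]) simp
  moreover have "integrable ?M (indicator A :: _ \<Rightarrow> real)"
    by (intro integrable_real_indicator) (auto simp: emeasure_eq_measure)
  ultimately show ?thesis
    by (simp add: tendsto_L1_local_average_iff[OF D(1)])
qed

text \<open>By the \<pi>-\<lambda> theorem it suffices to pass from cylinders, which are stable
  under intersection and generate the sets, to complements and countable disjoint unions. Linearity
  handles complements and finite unions, domination by 1 the countable ones.\<close>

lemma tendsto_L1_local_average_indicator:
  assumes D: "\<And>n. D n \<subseteq> carrier G" "\<And>n. finite (D n)"
    and card: "filterlim (\<lambda>n. real (card (D n))) at_top sequentially"
    and A: "A \<in> sets (bernoulli_space G)"
  shows "tendsto_L1 (bernoulli_space G) (\<lambda>n. local_average G (D n) (indicator A))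
    (\<lambda>_. global_average G (indicator A))"
proof -
  let ?M = "bernoulli_space G" and ?\<Omega> = "carrier G \<rightarrow>\<^sub>E space unit_interval_measure"
  let ?P = "\<lambda>f. tendsto_L1 ?M (\<lambda>n. local_average G (D n) f) (\<lambda>_. global_average G f)"
  interpret prob_space ?M by (rule prob_space_bernoulli_space)
  have sets: "sets ?M = sigma_sets ?\<Omega> (prod_algebra (carrier G) (\<lambda>_. unit_interval_measure))"
    by (simp add: bernoulli_space_def sets_PiM)
  have space: "space ?M = ?\<Omega>"
    by (simp add: bernoulli_space_def space_PiM)
  have int: "integrable ?M (indicator B :: _ \<Rightarrow> real)" if "B \<in> sets ?M" for B
    using that by (intro integrable_real_indicator) (auto simp: emeasure_eq_measure)
  have zero: "?P (\<lambda>x. 0)"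
    by (simp add: tendsto_L1_def local_average_def[abs_def] global_average_def)
  \<comment> \<open>A constant sequence converges to any function that agrees with it on the space.
    This is needed for complements, since \<open>indicator (?\<Omega> - A)\<close> and
    \<open>1 - indicator A\<close> differ outside \<open>?\<Omega>\<close>.\<close>
  have eq_on: "?P f" if P: "?P g" and f: "integrable ?M f" and g: "integrable ?M g"
    and eq: "\<And>x. x \<in> space ?M \<Longrightarrow> f x = g x" for f g
    by (rule tendsto_L1_local_average_dominated[where s = "\<lambda>_. g" and w = "\<lambda>x. \<bar>g x\<bar>"])
      (use D f g P eq in auto)
  from A show ?thesis
    unfolding sets
  proof (induction rule: sigma_sets_induct_disjoint[OF Int_stable_prod_algebra prod_algebra_sets_into_space,
        consumes 1, case_names basic empty compl union])
    case (basic A)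
    then show ?case by (rule tendsto_L1_local_average_cylinder[OF D card])
  next
    case empty
    then show ?case using zero by (simp add: indicator_def[abs_def])
  next
    case (compl A)
    have A: "A \<in> sets ?M" using compl(1) by (simp add: sets)
    have one: "?P (\<lambda>_. 1)"
    proof -
      \<comment> \<open>The local average of the constant 1 is 1 only for nonempty
        \<open>D n\<close>; for empty \<open>D n\<close> it is 0.\<close>
      have "\<forall>\<^sub>F n in sequentially. card (D n) \<noteq> 0"
        using card[THEN filterlim_at_top_dense[THEN iffD1], rule_format, of 0]
        by eventually_elim simp
      then have "\<forall>\<^sub>F n in sequentially. expectation
          (\<lambda>x. \<bar>local_average G (D n) (\<lambda>_. 1) x - global_average G (\<lambda>_. 1)\<bar>) = 0"
        by eventually_elim (simp add: local_average_def global_average_def prob_space)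
      then show ?thesis
        by (subst tendsto_L1_local_average_iff[OF D(1)]) (auto intro: tendsto_eventually)
    qed
    have "?P (\<lambda>x. 1 + (-1) * indicator A x)"
      using int[OF A] compl(2) one D(1)
      by (intro tendsto_L1_local_average_add tendsto_L1_local_average_mult) auto
    then show ?case
    proof (rule eq_on)
      show "integrable ?M (indicator (?\<Omega> - A) :: _ \<Rightarrow> real)"
        unfolding space[symmetric] using A by (intro int) auto
      show "integrable ?M (\<lambda>x. 1 + (-1) * indicator A x :: real)"
        using int[OF A] by simp
      show "indicator (?\<Omega> - A) x = 1 + (-1) * (indicator A x :: real)" if "x \<in> space ?M" for x
        using that unfolding space by (simp split: split_indicator)
    qed
  next
    case (union F)
    have F: "F i \<in> sets ?M" for i using union(2) by (auto simp: sets)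
    \<comment> \<open>Disjointness makes each partial union's indicator a finite sum, covered by
      additivity. These indicators converge pointwise to that of the whole union.\<close>
    let ?s = "\<lambda>m x. indicator (\<Union>i<m. F i) x :: real"
    have "?P (?s m)" for m
    proof (induction m)
      case 0
      then show ?case using zero by (simp add: indicator_def[abs_def])
    next
      case (Suc m)
      have "?P (\<lambda>x. ?s m x + indicator (F m) x)"
        using Suc union(3) F int D(1) by (intro tendsto_L1_local_average_add) auto
      moreover have "?s (Suc m) = (\<lambda>x. ?s m x + indicator (F m) x)"
      proof -
        have "F i \<inter> F m = {}" if "i < m" for i
          using union(1) that by (simp add: disjoint_family_on_def)
        then have "(\<Union>i<m. F i) \<inter> F m = {}" by blast
        moreover have "(\<Union>i<Suc m. F i) = (\<Union>i<m. F i) \<union> F m"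
          by (auto simp: lessThan_Suc)
        ultimately show ?thesis
          by (simp add: indicator_add[symmetric] fun_eq_iff)
      qed
      ultimately show ?case by simp
    qed
    then show ?case
    proof (rule tendsto_L1_local_average_dominated[where s = ?s and w = "\<lambda>_. 1", OF D(1), rotated])
      show "(\<lambda>m. ?s m x) \<longlonglongrightarrow> indicator (\<Union>i. F i) x" for x
        by (rule LIMSEQ_indicator_UN)
      show "integrable ?M (?s m)" for m
        using F by (intro int sets.countable_UN') auto
      show "integrable ?M (indicator (\<Union>i. F i) :: _ \<Rightarrow> real)"
        using F by (intro int sets.countable_UN) auto
      show "\<bar>?s m x\<bar> \<le> 1" for m x
        by (simp split: split_indicator)
    qed simp
  qed
qed

section \<open>Extension to all integrable functions\<close>

theorem tendsto_L1_local_average: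
  assumes D: "\<And>n. D n \<subseteq> carrier G" "\<And>n. finite (D n)"
    and card: "filterlim (\<lambda>n. real (card (D n))) at_top sequentially"
    and f: "integrable (bernoulli_space G) f"
  shows "tendsto_L1 (bernoulli_space G) (\<lambda>n. local_average G (D n) f) (\<lambda>_. global_average G f)"
  using f
proof (induction rule: integrable_induct)
  case (base A c)
  then show ?case
    \<comment> \<open>The base function is \<open>indicator A x *\<^sub>R c\<close>, so the scalar
      has to be moved to the left.\<close>
    using tendsto_L1_local_average_mult[OF D(1) _ tendsto_L1_local_average_indicator[OF D card base(1)], of c]
    by (simp add: mult.commute)
next
  case (add f g)
  show ?case by (rule tendsto_L1_local_average_add[OF D(1)]) fact+
next
  case (lim f s)
  \<comment> \<open>The majorant \<open>2 * \<bar>f x\<bar>\<close> is the bound that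
    \<open>integrable_induct\<close> provides for the approximating sequence.\<close>
  show ?case
    by (rule tendsto_L1_local_average_dominated[where s = s and w = "\<lambda>x. 2 * \<bar>f x\<bar>", OF D(1)])
      (use lim in simp_all)
qed

end

theorem corollary2p2:
  fixes \<Gamma> :: "('a, 'b) monoid_scheme" and D :: "nat \<Rightarrow> 'a set"
    and f :: "('a \<Rightarrow> real) \<Rightarrow> real"
  assumes "group \<Gamma>" and "countable (carrier \<Gamma>)" and "infinite (carrier \<Gamma>)"
    and "\<And>n. finite (D n)" and "\<And>n. D n \<subseteq> carrier \<Gamma>"
    and "filterlim (\<lambda>n. real (card (D n)) / ln (real n)) at_top sequentially"
    and "integrable (bernoulli_space \<Gamma>) f"
  shows "tendsto_L1 (bernoulli_space \<Gamma>) (\<lambda>n. local_average \<Gamma> (D n) f) (\<lambda>_. global_average \<Gamma> f)"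
proof -
  \<comment> \<open>From \<open>n = 3\<close> on, \<open>ln (real n)\<close> is at least 1 because e
    is at most 3; dividing by it cannot increase the cardinality, which therefore tends to infinity
    with the quotient.\<close>
  have "\<forall>\<^sub>F n in sequentially. real (card (D n)) / ln (real n) \<le> real (card (D n))"
    using eventually_ge_at_top[of 3]
  proof eventually_elim
    case (elim n)
    then have "1 \<le> ln (real n)"
      using exp_le by (subst ln_ge_iff) auto
    then show ?case
      by (simp add: divide_le_eq mult_le_cancel_left1)
  qed
  then have "filterlim (\<lambda>n. real (card (D n))) at_top sequentially"
    by (rule filterlim_at_top_mono[OF assms(6)])
  then show ?thesis
    using assms by (intro group.tendsto_L1_local_average)
qed

end
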